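(* Let $g:[u,v]\subseteq\mathbb{R}\to\mathbb{R}$ be a twice differentiable function with $g''\in L_1[u,v]$ and $0\leq u<v$. Suppose that $|g''|$ is convex on $[u,v]$, that $\psi(x)$ is an increasing and positive monotone function on $(u,v]$, and that its derivative $\psi'(x)$ is continuous on $(u,v)$. Then for $\mu\in(0,1)$ and $q\geq 1$ we have \begin{align*} \left|\sigma_{\mu,\psi}(g;u,v)\right| &\leq\frac{(v-u)^2}{8}\left(\frac{1}{\mu+2}\right)^{1-\frac{1}{q}} \Biggl\{\left[\frac{1}{2(\mu+3)}|g''(u)|^q+\left(\frac{1}{\mu+2}-\frac{1}{2(\mu+3)}\right)|g''(v)|^q\right]^{\frac{1}{q}}\\ &\qquad+\left[\left(\frac{1}{\mu+2}-\frac{1}{2(\mu+3)}\right)|g''(u)|^q+\frac{1}{2(\mu+3)}|g''(v)|^q\right]^{\frac{1}{q}}\Biggr\}. \end{align*}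
   Context: For $\mu>0$, an increasing and positive monotone function $\psi$ with continuous derivative $\psi'$, and a function $f$, the left- and right-sided $\psi$-Riemann--Liouville fractional integrals based at a point $c$ are $$I^{\mu:\psi}_{c^+}f(x)=\frac{1}{\Gamma(\mu)}\int_{c}^{x}\psi'(t)(\psi(x)-\psi(t))^{\mu-1}f(t)\,dt\quad(x>c),$$ $$I^{\mu:\psi}_{c^-}f(x)=\frac{1}{\Gamma(\mu)}\int_{x}^{c}\psi'(t)(\psi(t)-\psi(x))^{\mu-1}f(t)\,dt\quad(x<c),$$ where $\Gamma$ is the Gamma function. With $\psi^{-1}$ denoting the inverse function of $\psi$, the quantity $\sigma_{\mu,\psi}(g;u,v)$ is defined by $$\sigma_{\mu,\psi}(g;u,v)=\frac{2^{\mu-1}\Gamma(\mu+2)}{(v-u)^\mu}\left[I^{\mu:\psi}_{\psi^{-1}\left(\frac{u+v}{2}\right)^+}(g\circ\psi)\left(\psi^{-1}(v)\right)+I^{\mu:\psi}_{\psi^{-1}\left(\frac{u+v}{2}\right)^-}(g\circ\psi)\left(\psi^{-1}(u)\right)\right]-(\mu+1)\,g\left(\frac{u+v}{2}\right).$$ *)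

theory Defs
  imports "HOL-Analysis.Analysis"
begin

text \<open>
  The \<open>\<psi>\<close>-Riemann--Liouville fractional integrals based at \<open>c\<close>, as Lebesgue integrals.
  They are meant for \<open>c < x\<close> and \<open>x < c\<close>, respectively. At the endpoints \<open>deriv \<psi>\<close> may be
  a junk value and \<open>0 powr (\<mu> - 1)\<close> is \<open>0\<close>; neither affects the integral.
\<close>

definition psi_RL_left ::
  "real \<Rightarrow> (real \<Rightarrow> real) \<Rightarrow> real \<Rightarrow> (real \<Rightarrow> real) \<Rightarrow> real \<Rightarrow> real" where
  "psi_RL_left \<mu> \<psi> c f x =
     1 / Gamma \<mu> *
       (LINT t:{c..x}|lebesgue. deriv \<psi> t * (\<psi> x - \<psi> t) powr (\<mu> - 1) * f t)"

definition psi_RL_right ::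
  "real \<Rightarrow> (real \<Rightarrow> real) \<Rightarrow> real \<Rightarrow> (real \<Rightarrow> real) \<Rightarrow> real \<Rightarrow> real" where
  "psi_RL_right \<mu> \<psi> c f x =
     1 / Gamma \<mu> *
       (LINT t:{x..c}|lebesgue. deriv \<psi> t * (\<psi> t - \<psi> x) powr (\<mu> - 1) * f t)"

text \<open>
  The set \<open>D\<close> is the domain of \<open>\<psi>\<close>, so \<open>\<psi>\<inverse>\<close> is \<open>inv_into D \<psi>\<close>; a function
  \<open>real \<Rightarrow> real\<close> does not carry its domain.
\<close>

definition psi_sigma ::
  "real \<Rightarrow> real set \<Rightarrow> (real \<Rightarrow> real) \<Rightarrow> (real \<Rightarrow> real) \<Rightarrow> real \<Rightarrow> real \<Rightarrow> real" where
  "psi_sigma \<mu> D \<psi> g u v =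
     2 powr (\<mu> - 1) * Gamma (\<mu> + 2) / (v - u) powr \<mu> *
       (psi_RL_left \<mu> \<psi> (inv_into D \<psi> ((u + v) / 2)) (g \<circ> \<psi>) (inv_into D \<psi> v) +
        psi_RL_right \<mu> \<psi> (inv_into D \<psi> ((u + v) / 2)) (g \<circ> \<psi>) (inv_into D \<psi> u))
     - (\<mu> + 1) * g ((u + v) / 2)"

end

theory Submission
  imports Defs
begin

text \<open>
  Put \<open>h = (v - u) / 2\<close>. The substitutions \<open>r = v - \<psi> t\<close> and \<open>r = \<psi> t - u\<close> remove \<open>\<psi>\<close>
  from the two fractional integrals and turn both into integrals of \<open>r powr (\<mu> - 1) * G r\<close>
  over \<open>{0..h}\<close>, with \<open>G r = g (v - r)\<close> and \<open>G r = g (u + r)\<close> respectively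
  (\<open>psi_RL_eq_integral_powr_kernel\<close>).
  Two integrations by parts (\<open>integral_powr_kernel_by_parts\<close>) produce boundary terms at \<open>r = h\<close>,
  that is, at the midpoint. When the two integrals are added, the terms with \<open>g'\<close> cancel, since the
  midpoint is approached from opposite sides, and those with \<open>g\<close> are what \<open>\<sigma>\<close> subtracts.
  What remains (\<open>psi_sigma_eq_second_derivative_moment\<close>) is
  \<open>1 / (2 * h powr \<mu>)\<close> times the integral of \<open>r powr (\<mu> + 1) * (g'' (v - r) + g'' (u + r))\<close>
  over \<open>{0..h}\<close>.

  Convexity bounds \<open>\<bar>g''\<bar>\<close> by its chord over \<open>{u..v}\<close>, so each half of this integral is at most
  \<open>h powr (\<mu> + 2)\<close> times a combination of \<open>\<bar>g'' u\<bar>\<close> and \<open>\<bar>g'' v\<bar>\<close> with weights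
  \<open>1 / (\<mu> + 2) - 1 / (2 * (\<mu> + 3))\<close> and \<open>1 / (2 * (\<mu> + 3))\<close>, whose sum is \<open>1 / (\<mu> + 2)\<close>
  (\<open>powr_moment_le_of_chord_bound\<close>). This is the inequality for \<open>q = 1\<close>. It implies the one for every
  \<open>q \<ge> 1\<close> by the power mean inequality for two numbers (\<open>weighted_power_mean\<close>).
\<close>

section \<open>The power mean inequality for two numbers\<close>

text \<open>
  After division by \<open>A + B\<close> this is Jensen's inequality for \<open>x \<mapsto> x powr q\<close>. Its second
  derivative gives convexity for positive arguments; if one argument vanishes, the inequality
  reduces to \<open>w powr q \<le> w\<close> for a weight \<open>w\<close> between \<open>0\<close> and \<open>1\<close>.
\<close>

lemma weighted_power_mean:
  fixes A B a b q :: real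
  assumes A: "0 < A" and B: "0 < B" and a: "0 \<le> a" and b: "0 \<le> b" and q: "1 \<le> q"
  shows "A * a + B * b \<le> (A + B) powr (1 - 1 / q) * (A * a powr q + B * b powr q) powr (1 / q)"
proof -
  define s where "s = B / (A + B)"
  have s: "0 < s" "s < 1" and s1: "1 - s = A / (A + B)"
    using A B by (auto simp: s_def field_simps)
  have shrink: "(w * x) powr q \<le> w * x powr q" if "0 < w" "w < 1" "0 \<le> x" for w x :: real
  proof -
    have "w powr q \<le> w powr 1" using that q by (intro powr_mono') auto
    then show ?thesis using that by (simp add: powr_mult mult_right_mono)
  qed
  have convex: "((1 - s) * a + s * b) powr q \<le> (1 - s) * a powr q + s * b powr q"
  proof (cases "a = 0 \<or> b = 0")
    case True
    then show ?thesis using shrink[of s b] shrink[of "1 - s" a] s a b q by auto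
  next
    case False
    then show ?thesis
      using convex_onD[OF powr_convex[OF q], of s a b] a b s by simp
  qed
  have "((A * a + B * b) / (A + B)) powr q \<le> (A * a powr q + B * b powr q) / (A + B)"
    using convex unfolding s1 by (simp add: s_def add_divide_distrib)
  then have "(((A * a + B * b) / (A + B)) powr q) powr (1 / q)
      \<le> ((A * a powr q + B * b powr q) / (A + B)) powr (1 / q)"
    using q by (intro powr_mono2) auto
  then have "(A * a + B * b) / (A + B) \<le> (A * a powr q + B * b powr q) powr (1 / q) / (A + B) powr (1 / q)"
    using A B a b q by (simp add: powr_powr powr_divide)
  then have "A * a + B * b \<le> (A + B) * ((A * a powr q + B * b powr q) powr (1 / q) / (A + B) powr (1 / q))"
    using A B by (simp add: field_simps)
  also have "\<dots> = (A + B) powr (1 - 1 / q) * (A * a powr q + B * b powr q) powr (1 / q)"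
    using A B by (simp add: powr_diff)
  finally show ?thesis .
qed

section \<open>Integrals against a power kernel\<close>

lemma powr_times_continuous_absolutely_integrable:
  fixes G :: "real \<Rightarrow> real"
  assumes "0 < \<mu>" "0 \<le> h" "continuous_on {0..h} G"
  shows "(\<lambda>r. r powr (\<mu> - 1) * G r) absolutely_integrable_on {0..h}"
proof -
  have "(\<lambda>r. r powr (\<mu> - 1)) integrable_on {0..h}"
    using has_integral_powr_from_0[of "\<mu> - 1" h] assms by (auto simp: integrable_on_def)
  then have "(\<lambda>r. r powr (\<mu> - 1)) absolutely_integrable_on {0..h}"
    by (intro nonnegative_absolutely_integrable_1) auto
  moreover have "G \<in> borel_measurable (lebesgue_on {0..h})"
    using assms(3) by (intro continuous_imp_measurable_on_sets_lebesgue) auto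
  moreover have "bounded (G ` {0..h})"
    using assms(3) compact_continuous_image compact_imp_bounded by blast
  ultimately have "(\<lambda>r. G r * r powr (\<mu> - 1)) absolutely_integrable_on {0..h}"
    by (intro absolutely_integrable_bounded_measurable_product_real) auto
  then show ?thesis by (simp add: mult.commute)
qed

lemma continuous_times_absolutely_integrable:
  fixes k f :: "real \<Rightarrow> real"
  assumes "continuous_on {a..b} k" "f absolutely_integrable_on {a..b}"
  shows "(\<lambda>r. k r * f r) absolutely_integrable_on {a..b}"
proof (rule absolutely_integrable_bounded_measurable_product_real)
  show "k \<in> borel_measurable (lebesgue_on {a..b})"
    using assms(1) by (intro continuous_imp_measurable_on_sets_lebesgue) auto
  show "bounded (k ` {a..b})"
    using assms(1) compact_continuous_image compact_imp_bounded by blast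
qed (use assms in auto)

text \<open>
  Both integrations by parts are done at once: the function \<open>F\<close> of the boundary terms is continuous
  up to \<open>0\<close>, where it vanishes because \<open>\<mu> > 0\<close>, and in its derivative the terms with \<open>G'\<close> cancel.
  The fundamental theorem needs differentiability in the open interval only, so the
  singularity of the kernel at \<open>0\<close> is harmless.
\<close>

lemma integral_powr_kernel_by_parts:
  fixes G G' G'' :: "real \<Rightarrow> real"
  assumes \<mu>: "0 < \<mu>" and h: "0 \<le> h"
    and G: "\<And>r. r \<in> {0..h} \<Longrightarrow> (G has_real_derivative G' r) (at r within {0..h})"
    and G': "\<And>r. r \<in> {0..h} \<Longrightarrow> (G' has_real_derivative G'' r) (at r within {0..h})"
    and G'': "G'' absolutely_integrable_on {0..h}"
  shows "integral {0..h} (\<lambda>r. r powr (\<mu> - 1) * G r)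
    = h powr \<mu> / \<mu> * G h - h powr (\<mu> + 1) / (\<mu> * (\<mu> + 1)) * G' h
      + 1 / (\<mu> * (\<mu> + 1)) * integral {0..h} (\<lambda>r. r powr (\<mu> + 1) * G'' r)"
proof -
  have cG: "continuous_on {0..h} G" using G by (rule DERIV_continuous_on)
  have cG': "continuous_on {0..h} G'" using G' by (rule DERIV_continuous_on)
  have c: "continuous_on {0..h} (\<lambda>r. r powr p)" if "0 < p" for p :: real
    using that by (intro continuous_on_powr' continuous_intros) auto
  define F where "F r = r powr \<mu> / \<mu> * G r - r powr (\<mu> + 1) / (\<mu> * (\<mu> + 1)) * G' r" for r
  define f where "f r = r powr (\<mu> - 1) * G r - 1 / (\<mu> * (\<mu> + 1)) * (r powr (\<mu> + 1) * G'' r)" for r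
  have "(f has_integral F h - F 0) {0..h}"
  proof (rule fundamental_theorem_of_calculus_interior[OF h])
    show "continuous_on {0..h} F"
      unfolding F_def using \<mu>
      by (intro continuous_on_diff continuous_on_mult continuous_on_divide continuous_on_const cG cG' c) auto
    fix r assume r: "r \<in> {0<..<h}"
    have "(G has_real_derivative G' r) (at r)" "(G' has_real_derivative G'' r) (at r)"
      using G[of r] G'[of r] r at_within_Icc_at[of 0 r h] by auto
    moreover have "((\<lambda>r. r powr \<mu> / \<mu>) has_real_derivative r powr (\<mu> - 1)) (at r)"
      using DERIV_cdivide[OF has_real_derivative_powr[of r \<mu>], of \<mu>] r \<mu> by simp
    moreover have "((\<lambda>r. r powr (\<mu> + 1) / (\<mu> * (\<mu> + 1))) has_real_derivative r powr \<mu> / \<mu>) (at r)"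
      using DERIV_cdivide[OF has_real_derivative_powr[of r "\<mu> + 1"], of "\<mu> * (\<mu> + 1)"] r \<mu> by simp
    ultimately have "(F has_real_derivative
        (r powr (\<mu> - 1) * G r + G' r * (r powr \<mu> / \<mu>))
        - (r powr \<mu> / \<mu> * G' r + G'' r * (r powr (\<mu> + 1) / (\<mu> * (\<mu> + 1))))) (at r)"
      unfolding F_def[abs_def] by (intro DERIV_diff DERIV_mult)
    also have "(r powr (\<mu> - 1) * G r + G' r * (r powr \<mu> / \<mu>))
        - (r powr \<mu> / \<mu> * G' r + G'' r * (r powr (\<mu> + 1) / (\<mu> * (\<mu> + 1)))) = f r"
      by (simp add: f_def)
    finally show "(F has_vector_derivative f r) (at r)"
      by (simp add: has_real_derivative_iff_has_vector_derivative)
  qed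
  moreover have "(\<lambda>r. r powr (\<mu> + 1) * G'' r) integrable_on {0..h}"
    using continuous_times_absolutely_integrable[OF c G''] \<mu>
    by (auto intro: set_lebesgue_integral_eq_integral)
  then have "((\<lambda>r. 1 / (\<mu> * (\<mu> + 1)) * (r powr (\<mu> + 1) * G'' r)) has_integral
      1 / (\<mu> * (\<mu> + 1)) * integral {0..h} (\<lambda>r. r powr (\<mu> + 1) * G'' r)) {0..h}"
    by (intro has_integral_mult_right integrable_integral)
  ultimately have "((\<lambda>r. f r + 1 / (\<mu> * (\<mu> + 1)) * (r powr (\<mu> + 1) * G'' r)) has_integral
      F h - F 0 + 1 / (\<mu> * (\<mu> + 1)) * integral {0..h} (\<lambda>r. r powr (\<mu> + 1) * G'' r)) {0..h}"
    by (rule has_integral_add)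
  then have "integral {0..h} (\<lambda>r. r powr (\<mu> - 1) * G r)
      = F h - F 0 + 1 / (\<mu> * (\<mu> + 1)) * integral {0..h} (\<lambda>r. r powr (\<mu> + 1) * G'' r)"
    by (intro integral_unique) (simp add: f_def)
  then show ?thesis by (simp add: F_def)
qed

text \<open>
  The weights are the moments of the two barycentric coordinates \<open>1 - r / (2 * h)\<close> and
  \<open>r / (2 * h)\<close>. The denominator is \<open>2 * h\<close> because the chord spans an interval twice as long as the
  range of integration.
\<close>

lemma powr_moment_le_of_chord_bound:
  fixes f :: "real \<Rightarrow> real"
  assumes \<mu>: "0 < \<mu>" and h: "0 < h"
    and f: "f absolutely_integrable_on {0..h}"
    and chord: "\<And>r. r \<in> {0..h} \<Longrightarrow> \<bar>f r\<bar> \<le> (1 - r / (2 * h)) * a + r / (2 * h) * b"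
  shows "\<bar>integral {0..h} (\<lambda>r. r powr (\<mu> + 1) * f r)\<bar>
    \<le> h powr (\<mu> + 2) * ((1 / (\<mu> + 2) - 1 / (2 * (\<mu> + 3))) * a + 1 / (2 * (\<mu> + 3)) * b)"
proof -
  have I: "((\<lambda>r. r powr (\<mu> + 1)) has_integral h powr (\<mu> + 2) / (\<mu> + 2)) {0..h}"
    "((\<lambda>r. r powr (\<mu> + 2)) has_integral h powr (\<mu> + 3) / (\<mu> + 3)) {0..h}"
    using has_integral_powr_from_0[of "\<mu> + 1" h] has_integral_powr_from_0[of "\<mu> + 2" h] \<mu> h
    by (simp_all add: add.commute add.left_commute)
  have "((\<lambda>r. a * r powr (\<mu> + 1) + (b - a) / (2 * h) * r powr (\<mu> + 2)) has_integral
      a * (h powr (\<mu> + 2) / (\<mu> + 2)) + (b - a) / (2 * h) * (h powr (\<mu> + 3) / (\<mu> + 3))) {0..h}"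
    by (intro has_integral_add has_integral_mult_right I)
  moreover have "a * (h powr (\<mu> + 2) / (\<mu> + 2)) + (b - a) / (2 * h) * (h powr (\<mu> + 3) / (\<mu> + 3))
      = h powr (\<mu> + 2) * ((1 / (\<mu> + 2) - 1 / (2 * (\<mu> + 3))) * a + 1 / (2 * (\<mu> + 3)) * b)"
  proof -
    have "h powr (\<mu> + 3) = h * h powr (\<mu> + 2)"
      using h powr_add[of h 1 "\<mu> + 2"] by (simp add: algebra_simps)
    then have "(b - a) / (2 * h) * (h powr (\<mu> + 3) / (\<mu> + 3)) = h powr (\<mu> + 2) * ((b - a) * (1 / (2 * (\<mu> + 3))))"
      using h by (simp add: mult_ac)
    moreover have "a * (H / z) + H * ((b - a) * w) = H * ((1 / z - w) * a + w * b)" for H z w :: real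
      by (simp add: algebra_simps)
    ultimately show ?thesis by metis
  qed
  ultimately have J: "((\<lambda>r. a * r powr (\<mu> + 1) + (b - a) / (2 * h) * r powr (\<mu> + 2)) has_integral
      h powr (\<mu> + 2) * ((1 / (\<mu> + 2) - 1 / (2 * (\<mu> + 3))) * a + 1 / (2 * (\<mu> + 3)) * b)) {0..h}"
    by (simp only:)
  have "norm (integral {0..h} (\<lambda>r. r powr (\<mu> + 1) * f r))
      \<le> integral {0..h} (\<lambda>r. a * r powr (\<mu> + 1) + (b - a) / (2 * h) * r powr (\<mu> + 2))"
  proof (rule integral_norm_bound_integral)
    have "continuous_on {0..h} (\<lambda>r. r powr (\<mu> + 1))"
      using \<mu> by (intro continuous_on_powr' continuous_intros) auto
    then show "(\<lambda>r. r powr (\<mu> + 1) * f r) integrable_on {0..h}"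
      using f by (intro set_lebesgue_integral_eq_integral continuous_times_absolutely_integrable)
    show "(\<lambda>r. a * r powr (\<mu> + 1) + (b - a) / (2 * h) * r powr (\<mu> + 2)) integrable_on {0..h}"
      using J by (auto simp: integrable_on_def)
    fix r assume r: "r \<in> {0..h}"
    have e: "r powr (\<mu> + 2) = r * r powr (\<mu> + 1)"
      using r powr_add[of r 1 "\<mu> + 1"] by (cases "r = 0") (auto simp: algebra_simps)
    have "norm (r powr (\<mu> + 1) * f r) \<le> r powr (\<mu> + 1) * ((1 - r / (2 * h)) * a + r / (2 * h) * b)"
      using chord[OF r] by (simp add: abs_mult mult_left_mono)
    also have "\<dots> = a * r powr (\<mu> + 1) + (b - a) / (2 * h) * r powr (\<mu> + 2)"
      unfolding e using h by (simp add: field_simps)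
    finally show "norm (r powr (\<mu> + 1) * f r) \<le> a * r powr (\<mu> + 1) + (b - a) / (2 * h) * r powr (\<mu> + 2)" .
  qed
  then show ?thesis using J by (simp add: integral_unique)
qed

section \<open>Removing the change of variable \<open>\<psi>\<close>\<close>

text \<open>
  The substitution is made on the open interval, because \<open>\<phi>\<close> may fail to be differentiable at the
  endpoints, and there the integrand \<open>k\<close> is arbitrary. Absolute integrability is carried over from \<open>f\<close> to \<open>k\<close>, so
  the Lebesgue integral on the left is not the default value \<open>0\<close> of a divergent one. The absolute value of \<open>\<phi>'\<close> lets
  one statement serve increasing and decreasing substitutions.
\<close>

lemma lebesgue_integral_substitution_open_interval:
  fixes \<phi> \<phi>' f k :: "real \<Rightarrow> real"
  assumes "\<And>t. t \<in> {a<..<b} \<Longrightarrow> (\<phi> has_real_derivative \<phi>' t) (at t)"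
    and "inj_on \<phi> {a<..<b}" and img: "\<phi> ` {a<..<b} = {0<..<h}"
    and f: "f absolutely_integrable_on {0..h}"
    and k: "\<And>t. t \<in> {a<..<b} \<Longrightarrow> k t = \<bar>\<phi>' t\<bar> * f (\<phi> t)"
  shows "(LINT t:{a..b}|lebesgue. k t) = integral {0..h} f"
proof -
  have "f absolutely_integrable_on {0<..<h}"
    using f by (rule set_integrable_subset) auto
  moreover have "(\<lambda>t. \<bar>\<phi>' t\<bar> * f (\<phi> t)) absolutely_integrable_on {a<..<b}
      \<and> integral {a<..<b} (\<lambda>t. \<bar>\<phi>' t\<bar> * f (\<phi> t)) = integral {0<..<h} f
    \<longleftrightarrow> f absolutely_integrable_on (\<phi> ` {a<..<b}) \<and> integral (\<phi> ` {a<..<b}) f = integral {0<..<h} f"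
    using assms(1,2)
    by (intro has_absolute_integral_change_of_variables_1'[where g = \<phi>])
       (auto intro: has_field_derivative_at_within)
  ultimately have "(\<lambda>t. \<bar>\<phi>' t\<bar> * f (\<phi> t)) absolutely_integrable_on {a<..<b}"
    and I: "integral {a<..<b} (\<lambda>t. \<bar>\<phi>' t\<bar> * f (\<phi> t)) = integral {0<..<h} f"
    by (auto simp: img)
  then have "k absolutely_integrable_on {a<..<b}"
    using k by (subst set_integrable_cong[OF refl refl k]) auto
  then have "k absolutely_integrable_on {a..b}"
    by (rule absolutely_integrable_spike_set)
       (auto intro!: negligible_subset[OF negligible_finite[of "{a, b}"]])
  then have "(LINT t:{a..b}|lebesgue. k t) = integral {a..b} k"
    by (rule set_lebesgue_integral_eq_integral)
  also have "\<dots> = integral {a<..<b} k"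
    by (rule integral_open_interval_real)
  also have "\<dots> = integral {a<..<b} (\<lambda>t. \<bar>\<phi>' t\<bar> * f (\<phi> t))"
    using k by (rule integral_cong)
  also have "\<dots> = integral {0..h} f"
    using I by (simp add: integral_open_interval_real)
  finally show ?thesis .
qed

text \<open>
  A jump of a monotone function leaves a gap in its values, so the inclusion in \<open>\<psi> ` D\<close>
  excludes jumps, also at the endpoints.
\<close>

lemma strict_mono_on_image_open_interval:
  fixes \<psi> :: "real \<Rightarrow> real"
  assumes mono: "strict_mono_on D \<psi>" and D: "is_interval D"
    and a: "a \<in> D" and b: "b \<in> D" and range: "{\<psi> a..\<psi> b} \<subseteq> \<psi> ` D"
  shows "\<psi> ` {a<..<b} = {\<psi> a<..<\<psi> b}"
proof -
  have less: "\<psi> s < \<psi> t \<longleftrightarrow> s < t" if "s \<in> D" "t \<in> D" for s t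
    using mono that by (meson strict_mono_on_less)
  have "{a<..<b} \<subseteq> D"
    using D a b by (auto intro: mem_is_interval_1_I[of D a b])
  then have "\<psi> t \<in> {\<psi> a<..<\<psi> b}" if "t \<in> {a<..<b}" for t
    using that less a b by (metis greaterThanLessThan_iff subset_iff)
  moreover have "s \<in> \<psi> ` {a<..<b}" if s: "s \<in> {\<psi> a<..<\<psi> b}" for s
  proof -
    obtain t where t: "t \<in> D" "s = \<psi> t"
      using range s by (meson greaterThanLessThan_subseteq_atLeastAtMost_iff imageE order_refl subsetD)
    then show ?thesis using s less a b by auto
  qed
  ultimately show ?thesis by blast
qed

lemma psi_RL_eq_integral_powr_kernel:
  fixes g \<psi> :: "real \<Rightarrow> real"
  assumes \<mu>: "0 < \<mu>" and mono: "strict_mono_on D \<psi>" and D: "is_interval D"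
    and diff: "\<And>x. x \<in> interior D \<Longrightarrow> \<psi> differentiable (at x)"
    and a: "a \<in> D" and b: "b \<in> D" and ab: "a < b" and range: "{\<psi> a..\<psi> b} \<subseteq> \<psi> ` D"
    and g: "continuous_on {\<psi> a..\<psi> b} g"
  shows "psi_RL_left \<mu> \<psi> a (g \<circ> \<psi>) b
      = 1 / Gamma \<mu> * integral {0..\<psi> b - \<psi> a} (\<lambda>r. r powr (\<mu> - 1) * g (\<psi> b - r))" (is ?left)
    and "psi_RL_right \<mu> \<psi> b (g \<circ> \<psi>) a
      = 1 / Gamma \<mu> * integral {0..\<psi> b - \<psi> a} (\<lambda>r. r powr (\<mu> - 1) * g (\<psi> a + r))" (is ?right)
proof -
  have sub: "{a<..<b} \<subseteq> D"
    using D a b by (auto intro: mem_is_interval_1_I[of D a b])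
  then have int: "{a<..<b} \<subseteq> interior D"
    by (simp add: interior_maximal)
  have der: "(\<psi> has_real_derivative deriv \<psi> t) (at t)" if "t \<in> {a<..<b}" for t
    using diff[of t] that int by (auto simp: DERIV_deriv_iff_real_differentiable)
  have pos: "0 \<le> deriv \<psi> t" if "t \<in> {a<..<b}" for t
  proof (rule mono_on_imp_deriv_nonneg)
    show "mono_on D \<psi>" using mono by (rule strict_mono_on_imp_mono_on)
    show "(\<psi> has_real_derivative deriv \<psi> t) (at t)" using der that .
    show "t \<in> interior D" using that int by auto
  qed
  have img: "\<psi> ` {a<..<b} = {\<psi> a<..<\<psi> b}"
    using strict_mono_on_image_open_interval[OF mono D a b range] .
  have inj: "inj_on \<psi> {a<..<b}"
    using mono sub by (meson inj_on_subset strict_mono_on_imp_inj_on)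
  have le: "0 \<le> \<psi> b - \<psi> a"
    using mono a b ab by (smt (verit) strict_mono_onD)
  have "(LINT t:{a..b}|lebesgue. deriv \<psi> t * (\<psi> b - \<psi> t) powr (\<mu> - 1) * (g \<circ> \<psi>) t)
      = integral {0..\<psi> b - \<psi> a} (\<lambda>r. r powr (\<mu> - 1) * g (\<psi> b - r))"
  proof (rule lebesgue_integral_substitution_open_interval)
    show "((\<lambda>t. \<psi> b - \<psi> t) has_real_derivative - deriv \<psi> t) (at t)" if "t \<in> {a<..<b}" for t
      using der[OF that] by (auto intro!: derivative_eq_intros)
    show "inj_on (\<lambda>t. \<psi> b - \<psi> t) {a<..<b}" using inj by (simp add: inj_on_def)
    have "(\<lambda>t. \<psi> b - \<psi> t) ` {a<..<b} = (\<lambda>s. \<psi> b - s) ` {\<psi> a<..<\<psi> b}"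
      by (simp add: img[symmetric] image_image)
    also have "\<dots> = {0<..<\<psi> b - \<psi> a}"
      by (auto simp: image_iff intro!: bexI[where x = "\<psi> b - _"])
    finally show "(\<lambda>t. \<psi> b - \<psi> t) ` {a<..<b} = {0<..<\<psi> b - \<psi> a}" .
    show "(\<lambda>r. r powr (\<mu> - 1) * g (\<psi> b - r)) absolutely_integrable_on {0..\<psi> b - \<psi> a}"
      using \<mu> le
      by (intro powr_times_continuous_absolutely_integrable continuous_on_compose2[OF g] continuous_intros) auto
  qed (use pos in auto)
  then show ?left by (simp add: psi_RL_left_def)
  have "(LINT t:{a..b}|lebesgue. deriv \<psi> t * (\<psi> t - \<psi> a) powr (\<mu> - 1) * (g \<circ> \<psi>) t)
      = integral {0..\<psi> b - \<psi> a} (\<lambda>r. r powr (\<mu> - 1) * g (\<psi> a + r))"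
  proof (rule lebesgue_integral_substitution_open_interval)
    show "((\<lambda>t. \<psi> t - \<psi> a) has_real_derivative deriv \<psi> t) (at t)" if "t \<in> {a<..<b}" for t
      using der[OF that] by (auto intro!: derivative_eq_intros)
    show "inj_on (\<lambda>t. \<psi> t - \<psi> a) {a<..<b}" using inj by (simp add: inj_on_def)
    have "(\<lambda>t. \<psi> t - \<psi> a) ` {a<..<b} = (\<lambda>s. s - \<psi> a) ` {\<psi> a<..<\<psi> b}"
      by (simp add: img[symmetric] image_image)
    also have "\<dots> = {0<..<\<psi> b - \<psi> a}"
      by (auto simp: image_iff intro!: bexI[where x = "\<psi> a + _"])
    finally show "(\<lambda>t. \<psi> t - \<psi> a) ` {a<..<b} = {0<..<\<psi> b - \<psi> a}" .
    show "(\<lambda>r. r powr (\<mu> - 1) * g (\<psi> a + r)) absolutely_integrable_on {0..\<psi> b - \<psi> a}"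
      using \<mu> le
      by (intro powr_times_continuous_absolutely_integrable continuous_on_compose2[OF g] continuous_intros) auto
  qed (use pos in auto)
  then show ?right by (simp add: psi_RL_right_def)
qed

section \<open>The integral identity\<close>

text \<open>
  The normalising factor of \<open>\<sigma>\<close> is chosen for this identity: \<open>Gamma (\<mu> + 2) / Gamma \<mu>\<close> is
  \<open>\<mu> * (\<mu> + 1)\<close>, the factor that two integrations by parts introduce into the denominator.
\<close>

lemma psi_sigma_eq_second_derivative_moment:
  fixes g g' g'' \<psi> :: "real \<Rightarrow> real"
  assumes uv: "u < v" and h: "h = (v - u) / 2"
    and g: "\<And>x. x \<in> {u..v} \<Longrightarrow> (g has_real_derivative g' x) (at x within {u..v})"
    and g': "\<And>x. x \<in> {u..v} \<Longrightarrow> (g' has_real_derivative g'' x) (at x within {u..v})"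
    and up: "(\<lambda>r. g'' (u + r)) absolutely_integrable_on {0..h}"
    and down: "(\<lambda>r. g'' (v - r)) absolutely_integrable_on {0..h}"
    and D: "is_interval D" and mono: "strict_mono_on D \<psi>"
    and diff: "\<And>x. x \<in> interior D \<Longrightarrow> \<psi> differentiable (at x)"
    and range: "{u..v} \<subseteq> \<psi> ` D" and \<mu>: "0 < \<mu>"
  shows "psi_sigma \<mu> D \<psi> g u v = 1 / (2 * h powr \<mu>) *
    (integral {0..h} (\<lambda>r. r powr (\<mu> + 1) * g'' (v - r))
     + integral {0..h} (\<lambda>r. r powr (\<mu> + 1) * g'' (u + r)))"
proof -
  define m where "m = (u + v) / 2"
  have h0: "0 < h" and um: "u + h = m" and vm: "v - h = m" and "v - u = 2 * h"
    using uv h by (auto simp: m_def field_simps)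
  have m: "u < m" "m < v" using um vm h0 by auto
  define a c b where "a = inv_into D \<psi> u" and "c = inv_into D \<psi> m" and "b = inv_into D \<psi> v"
  have "u \<in> \<psi> ` D" "m \<in> \<psi> ` D" "v \<in> \<psi> ` D"
    using range m by auto
  then have mem: "a \<in> D" "c \<in> D" "b \<in> D" and val: "\<psi> a = u" "\<psi> c = m" "\<psi> b = v"
    by (auto simp: a_def b_def c_def inv_into_into f_inv_into_f)
  have ord: "a < c" "c < b"
    using m mem val mono by (metis strict_mono_on_less)+
  have cg: "continuous_on {u..v} g"
    using g by (rule DERIV_continuous_on)
  have L: "psi_RL_left \<mu> \<psi> c (g \<circ> \<psi>) b
      = 1 / Gamma \<mu> * integral {0..h} (\<lambda>r. r powr (\<mu> - 1) * g (v - r))"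
  proof -
    have "{\<psi> c..\<psi> b} \<subseteq> \<psi> ` D" "continuous_on {\<psi> c..\<psi> b} g" "\<psi> b - \<psi> c = h"
      using m vm val range cg by (auto intro: continuous_on_subset)
    then show ?thesis
      using psi_RL_eq_integral_powr_kernel(1)[OF \<mu> mono D diff mem(2,3) ord(2)] val by simp
  qed
  have R: "psi_RL_right \<mu> \<psi> c (g \<circ> \<psi>) a
      = 1 / Gamma \<mu> * integral {0..h} (\<lambda>r. r powr (\<mu> - 1) * g (u + r))"
  proof -
    have "{\<psi> a..\<psi> c} \<subseteq> \<psi> ` D" "continuous_on {\<psi> a..\<psi> c} g" "\<psi> c - \<psi> a = h"
      using m um val range cg by (auto intro: continuous_on_subset)
    then show ?thesis
      using psi_RL_eq_integral_powr_kernel(2)[OF \<mu> mono D diff mem(1,2) ord(1)] val by simp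
  qed
  \<comment> \<open>The reflection changes the sign of every first derivative. Hence the two boundary terms with
    \<open>g'\<close> at the midpoint \<open>m\<close> have opposite signs in \<open>Pv\<close> and \<open>Pu\<close>.\<close>
  have reflect: "((\<lambda>r. F (v - r)) has_real_derivative - F' (v - r)) (at r within {0..h})"
    if F: "\<And>x. x \<in> {u..v} \<Longrightarrow> (F has_real_derivative F' x) (at x within {u..v})" and r: "r \<in> {0..h}"
    for F F' :: "real \<Rightarrow> real" and r
  proof -
    have "((F \<circ> (\<lambda>r. v - r)) has_real_derivative F' (v - r) * (- 1)) (at r within {0..h})"
      using r vm m by (intro DERIV_image_chain DERIV_subset[OF F]) (auto intro!: derivative_eq_intros)
    then show ?thesis by (simp add: o_def)
  qed
  have shift: "((\<lambda>r. F (u + r)) has_real_derivative F' (u + r)) (at r within {0..h})"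
    if F: "\<And>x. x \<in> {u..v} \<Longrightarrow> (F has_real_derivative F' x) (at x within {u..v})" and r: "r \<in> {0..h}"
    for F F' :: "real \<Rightarrow> real" and r
  proof -
    have "((F \<circ> (\<lambda>r. u + r)) has_real_derivative F' (u + r) * 1) (at r within {0..h})"
      using r um m by (intro DERIV_image_chain DERIV_subset[OF F]) (auto intro!: derivative_eq_intros)
    then show ?thesis by (simp add: o_def)
  qed
  define Iv Iu where "Iv = integral {0..h} (\<lambda>r. r powr (\<mu> + 1) * g'' (v - r))"
    and "Iu = integral {0..h} (\<lambda>r. r powr (\<mu> + 1) * g'' (u + r))"
  have Pv: "integral {0..h} (\<lambda>r. r powr (\<mu> - 1) * g (v - r))
      = h powr \<mu> / \<mu> * g m + h powr (\<mu> + 1) / (\<mu> * (\<mu> + 1)) * g' m + 1 / (\<mu> * (\<mu> + 1)) * Iv"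
    using integral_powr_kernel_by_parts[of \<mu> h "\<lambda>r. g (v - r)" "\<lambda>r. - g' (v - r)" "\<lambda>r. g'' (v - r)"]
      \<mu> h0 reflect[OF g] DERIV_minus[OF reflect[OF g']] down
    by (simp add: vm Iv_def)
  have Pu: "integral {0..h} (\<lambda>r. r powr (\<mu> - 1) * g (u + r))
      = h powr \<mu> / \<mu> * g m - h powr (\<mu> + 1) / (\<mu> * (\<mu> + 1)) * g' m + 1 / (\<mu> * (\<mu> + 1)) * Iu"
    using integral_powr_kernel_by_parts[of \<mu> h "\<lambda>r. g (u + r)" "\<lambda>r. g' (u + r)" "\<lambda>r. g'' (u + r)"]
      \<mu> h0 shift[OF g] shift[OF g'] up
    by (simp add: um Iu_def)
  have gam: "Gamma (\<mu> + 2) = (\<mu> + 1) * \<mu> * Gamma \<mu>" and gam0: "Gamma \<mu> > 0"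
  proof -
    have "Gamma (\<mu> + 1 + 1) = (\<mu> + 1) * (\<mu> * Gamma \<mu>)"
      using \<mu> by (subst Gamma_plus1, force elim!: nonpos_Ints_cases)+ simp
    then show "Gamma (\<mu> + 2) = (\<mu> + 1) * \<mu> * Gamma \<mu>" by (simp add: add.assoc)
    show "Gamma \<mu> > 0" using \<mu> by (rule Gamma_real_pos)
  qed
  have coef: "2 powr (\<mu> - 1) / (2 * h) powr \<mu> = 1 / (2 * h powr \<mu>)"
    using h0 by (simp add: powr_mult powr_diff)
  have "psi_sigma \<mu> D \<psi> g u v
      = 2 powr (\<mu> - 1) * Gamma (\<mu> + 2) / (v - u) powr \<mu> * 
        (1 / Gamma \<mu> * (2 * (h powr \<mu> / \<mu> * g m) + 1 / (\<mu> * (\<mu> + 1)) * (Iv + Iu))) - (\<mu> + 1) * g m"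
    unfolding psi_sigma_def m_def[symmetric] a_def[symmetric] b_def[symmetric] c_def[symmetric] L R Pv Pu
    by (simp add: algebra_simps add_divide_distrib)
  also have "\<dots> = 2 powr (\<mu> - 1) / (2 * h) powr \<mu> * (\<mu> * (\<mu> + 1)) *
        (2 * (h powr \<mu> / \<mu> * g m) + 1 / (\<mu> * (\<mu> + 1)) * (Iv + Iu)) - (\<mu> + 1) * g m"
    unfolding gam \<open>v - u = 2 * h\<close> using gam0 by simp
  also have "\<dots> = 1 / (2 * h powr \<mu>) * (Iv + Iu)"
  proof -
    have "\<mu> * (\<mu> + 1) * (2 * (h powr \<mu> / \<mu> * g m) + 1 / (\<mu> * (\<mu> + 1)) * (Iv + Iu))
        = 2 * h powr \<mu> * ((\<mu> + 1) * g m) + (Iv + Iu)"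
    proof -
      have "\<mu> * (\<mu> + 1) * (2 * (h powr \<mu> / \<mu> * g m)) = 2 * h powr \<mu> * ((\<mu> + 1) * g m)"
        "\<mu> * (\<mu> + 1) * (1 / (\<mu> * (\<mu> + 1)) * (Iv + Iu)) = Iv + Iu"
        using \<mu> by simp_all
      then show ?thesis by (metis distrib_left)
    qed
    then show ?thesis
      unfolding coef mult.assoc[of "1 / (2 * h powr \<mu>)"] using h0 by (simp add: distrib_left)
  qed
  finally show ?thesis by (simp add: Iv_def Iu_def)
qed

section \<open>The inequality\<close>

theorem theorem2p1:
  fixes g g' g'' \<psi> :: "real \<Rightarrow> real" and D :: "real set" and u v \<mu> q :: real
  assumes "0 \<le> u" and "u < v"
    and "\<And>x. x \<in> {u..v} \<Longrightarrow> (g has_real_derivative g' x) (at x within {u..v})"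
    and "\<And>x. x \<in> {u..v} \<Longrightarrow> (g' has_real_derivative g'' x) (at x within {u..v})"
    and "set_integrable lebesgue {u..v} g''"
    and "convex_on {u..v} (\<lambda>x. \<bar>g'' x\<bar>)"
    and "is_interval D" and "{u<..v} \<subseteq> D"
    and "strict_mono_on D \<psi>"
    and "\<And>x. x \<in> {u<..v} \<Longrightarrow> 0 < \<psi> x"
    and "\<And>x. x \<in> interior D \<Longrightarrow> \<psi> differentiable (at x)"
    and "continuous_on (interior D) (deriv \<psi>)"
    and "{u..v} \<subseteq> \<psi> ` D"
    and "0 < \<mu>" and "\<mu> < 1" and "1 \<le> q"
  shows "\<bar>psi_sigma \<mu> D \<psi> g u v\<bar> \<le>
    (v - u)\<^sup>2 / 8 * (1 / (\<mu> + 2)) powr (1 - 1 / q) *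
      ((1 / (2 * (\<mu> + 3)) * \<bar>g'' u\<bar> powr q
          + (1 / (\<mu> + 2) - 1 / (2 * (\<mu> + 3))) * \<bar>g'' v\<bar> powr q) powr (1 / q)
       + ((1 / (\<mu> + 2) - 1 / (2 * (\<mu> + 3))) * \<bar>g'' u\<bar> powr q
          + 1 / (2 * (\<mu> + 3)) * \<bar>g'' v\<bar> powr q) powr (1 / q))"
proof -
  define h where "h = (v - u) / 2"
  \<comment> \<open>The weights of the nearer and of the farther endpoint.\<close>
  define A B where "A = 1 / (\<mu> + 2) - 1 / (2 * (\<mu> + 3))" and "B = 1 / (2 * (\<mu> + 3))"
  have AB: "0 < A" "0 < B" "A + B = 1 / (\<mu> + 2)"
    using \<open>0 < \<mu>\<close> by (auto simp: A_def B_def intro!: divide_strict_left_mono)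
  have "2 * h = v - u" by (simp add: h_def)
  then have h: "0 < h" "v = u + 2 * h" using \<open>u < v\<close> by linarith+
  have chord: "\<bar>g'' (u + r)\<bar> \<le> (1 - r / (2 * h)) * \<bar>g'' u\<bar> + r / (2 * h) * \<bar>g'' v\<bar>"
    "\<bar>g'' (v - r)\<bar> \<le> (1 - r / (2 * h)) * \<bar>g'' v\<bar> + r / (2 * h) * \<bar>g'' u\<bar>" if "r \<in> {0..h}" for r
  proof -
    have t: "0 \<le> r / (2 * h)" "r / (2 * h) \<le> 1" using that h by auto
    have "(1 - r / (2 * h)) * u + r / (2 * h) * v = u + r"
      "(1 - r / (2 * h)) * v + r / (2 * h) * u = v - r"
      using h by (auto simp: field_simps)
    then show "\<bar>g'' (u + r)\<bar> \<le> (1 - r / (2 * h)) * \<bar>g'' u\<bar> + r / (2 * h) * \<bar>g'' v\<bar>"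
      "\<bar>g'' (v - r)\<bar> \<le> (1 - r / (2 * h)) * \<bar>g'' v\<bar> + r / (2 * h) * \<bar>g'' u\<bar>"
      using convex_onD[OF \<open>convex_on {u..v} (\<lambda>x. \<bar>g'' x\<bar>)\<close> t, of u v]
        convex_onD[OF \<open>convex_on {u..v} (\<lambda>x. \<bar>g'' x\<bar>)\<close> t, of v u] \<open>u < v\<close> by auto
  qed
  have up: "(\<lambda>r. g'' (u + r)) absolutely_integrable_on {0..h}"
    and down: "(\<lambda>r. g'' (v - r)) absolutely_integrable_on {0..h}"
  proof -
    have "(\<lambda>r. \<bar>1\<bar> * g'' (u + r)) absolutely_integrable_on {0..2 * h} \<and>
          integral {0..2 * h} (\<lambda>r. \<bar>1\<bar> * g'' (u + r)) = integral {u..v} g''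
        \<longleftrightarrow> g'' absolutely_integrable_on ((\<lambda>r. u + r) ` {0..2 * h}) \<and>
          integral ((\<lambda>r. u + r) ` {0..2 * h}) g'' = integral {u..v} g''"
      by (intro has_absolute_integral_change_of_variables_1'[where g = "\<lambda>r. u + r"])
         (auto intro!: derivative_eq_intros)
    then have "(\<lambda>r. g'' (u + r)) absolutely_integrable_on {0..2 * h}"
      using \<open>set_integrable lebesgue {u..v} g''\<close> h by (simp add: add.commute)
    then show "(\<lambda>r. g'' (u + r)) absolutely_integrable_on {0..h}"
      using h by (elim set_integrable_subset) auto
    have "(\<lambda>r. \<bar>- 1\<bar> * g'' (v - r)) absolutely_integrable_on {0..2 * h} \<and>
          integral {0..2 * h} (\<lambda>r. \<bar>- 1\<bar> * g'' (v - r)) = integral {u..v} g''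
        \<longleftrightarrow> g'' absolutely_integrable_on ((\<lambda>r. v - r) ` {0..2 * h}) \<and>
          integral ((\<lambda>r. v - r) ` {0..2 * h}) g'' = integral {u..v} g''"
      by (intro has_absolute_integral_change_of_variables_1'[where g = "\<lambda>r. v - r"])
         (auto intro!: derivative_eq_intros simp: inj_on_def)
    then have "(\<lambda>r. g'' (v - r)) absolutely_integrable_on {0..2 * h}"
      using \<open>set_integrable lebesgue {u..v} g''\<close> h by (simp add: add.commute)
    then show "(\<lambda>r. g'' (v - r)) absolutely_integrable_on {0..h}"
      using h by (elim set_integrable_subset) auto
  qed
  define Iv Iu where "Iv = integral {0..h} (\<lambda>r. r powr (\<mu> + 1) * g'' (v - r))"
    and "Iu = integral {0..h} (\<lambda>r. r powr (\<mu> + 1) * g'' (u + r))"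
  define P where "P = (1 / (\<mu> + 2)) powr (1 - 1 / q)"
  define X Y where "X = (B * \<bar>g'' u\<bar> powr q + A * \<bar>g'' v\<bar> powr q) powr (1 / q)"
    and "Y = (A * \<bar>g'' u\<bar> powr q + B * \<bar>g'' v\<bar> powr q) powr (1 / q)"
  have "\<bar>Iv\<bar> \<le> h powr (\<mu> + 2) * (A * \<bar>g'' v\<bar> + B * \<bar>g'' u\<bar>)"
    unfolding Iv_def A_def B_def
    using \<open>0 < \<mu>\<close> h(1) down chord(2) by (rule powr_moment_le_of_chord_bound)
  moreover have "A * \<bar>g'' v\<bar> + B * \<bar>g'' u\<bar> \<le> P * X"
    using weighted_power_mean[OF AB(1,2) _ _ \<open>1 \<le> q\<close>, of "\<bar>g'' v\<bar>" "\<bar>g'' u\<bar>"]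
    by (simp add: P_def X_def AB(3) add.commute)
  ultimately have bv: "\<bar>Iv\<bar> \<le> h powr (\<mu> + 2) * (P * X)"
    by (meson mult_left_mono order_trans powr_ge_zero)
  have "\<bar>Iu\<bar> \<le> h powr (\<mu> + 2) * (A * \<bar>g'' u\<bar> + B * \<bar>g'' v\<bar>)"
    unfolding Iu_def A_def B_def
    using \<open>0 < \<mu>\<close> h(1) up chord(1) by (rule powr_moment_le_of_chord_bound)
  moreover have "A * \<bar>g'' u\<bar> + B * \<bar>g'' v\<bar> \<le> P * Y"
    using weighted_power_mean[OF AB(1,2) _ _ \<open>1 \<le> q\<close>, of "\<bar>g'' u\<bar>" "\<bar>g'' v\<bar>"]
    by (simp add: P_def Y_def AB(3))
  ultimately have bu: "\<bar>Iu\<bar> \<le> h powr (\<mu> + 2) * (P * Y)"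
    by (meson mult_left_mono order_trans powr_ge_zero)
  have "psi_sigma \<mu> D \<psi> g u v = 1 / (2 * h powr \<mu>) * (Iv + Iu)"
    unfolding Iv_def Iu_def
    using assms up down by (intro psi_sigma_eq_second_derivative_moment[OF _ h_def]) auto
  then have "\<bar>psi_sigma \<mu> D \<psi> g u v\<bar> = 1 / (2 * h powr \<mu>) * \<bar>Iv + Iu\<bar>"
    by (simp add: abs_mult)
  also have "\<dots> \<le> 1 / (2 * h powr \<mu>) * (h powr (\<mu> + 2) * (P * X) + h powr (\<mu> + 2) * (P * Y))"
    using bv bu by (intro mult_left_mono) auto
  also have "\<dots> = h\<^sup>2 / 2 * P * (X + Y)"
    using h by (simp add: powr_add field_simps)
  also have "h\<^sup>2 / 2 = (v - u)\<^sup>2 / 8"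
    by (simp add: h_def power2_eq_square)
  finally show ?thesis
    by (simp add: P_def X_def Y_def A_def B_def)
qed

end
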